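(* Let $P(t)$ be a rational function in $t$ of the form $$P(t)=\frac{B(t)}{\prod_{j\in J}(1-q^{-\nu_j}t^{N_j})},$$ where $J$ is a finite nonempty index set, $B(t)\in S[t]$, all $\nu_j$ and $N_j$ are in $\mathbb{Z}_{>0}$, and $B(t)$ is not divisible by any of the $1-q^{-\nu_j}t^{N_j}$, $j \in J$. Put $l:=\min\{-\nu_j/N_j\mid j\in J\}$ and define the numbers $M_i$ by $P(t)=\sum_{i=0}^{\infty}M_iq^{-ni}t^i$. Let $l'$ be a real number. If there exists an integer $a$ such that $M_i$ is an integer multiple of $q^{\lceil (n+l')i-a\rceil}$ for all $i\in\mathbb{Z}_{\geq 0}$, then $l'\leq l$.
   Context: $n$ is a positive integer and $q$ is the cardinality of the residue field of a $p$-adic field (a finite extension of $\mathbb{Q}_p$), so $q$ is a prime power. $S:=\{z/q^i\mid z\in\mathbb{Z},\ i\in\mathbb{Z}_{\geq 0}\}$. $\lceil y\rceil$ denotes the smallest integer larger than or equal to $y$. A rational number $x$ is an integer multiple of $q^k$ ($k\in\mathbb{Z}$, possibly negative) if $x=mq^k$ for some $m\in\mathbb{Z}$. *)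

theory Defs
  imports
    "HOL-Number_Theory.Prime_Powers"
    "HOL-Computational_Algebra.Polynomial_FPS"
begin

definition S_ring :: "nat \<Rightarrow> rat set" where
  "S_ring q = {of_int z / of_nat q ^ i | (z :: int) (i :: nat). True}"

definition S_poly :: "nat \<Rightarrow> rat poly set" where
  "S_poly q = {B. \<forall>i. coeff B i \<in> S_ring q}"

text \<open>
  As \<open>N > 0\<close>, the factor \<open>1 - q\<^sup>-\<^sup>\<nu> t\<^sup>N\<close> has constant term \<open>1\<close>, so it is invertible as a formal power
  series and dividing by it in \<open>rat fps\<close> is the power series expansion at \<open>t = 0\<close>.
\<close>

definition denom_factor :: "nat \<Rightarrow> nat \<Rightarrow> nat \<Rightarrow> rat poly" where
  "denom_factor q \<nu> N = 1 - monom (of_nat q powi (- int \<nu>)) N"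

text \<open>
  Divisibility inside \<open>S[t]\<close>, not in \<open>\<rat>[t]\<close>.  For \<open>D\<close> a \<open>denom_factor\<close> the two notions
  coincide, because \<open>D\<close> has coefficients in \<open>S\<close> and constant term \<open>1\<close>.
\<close>

definition dvd_in_S_poly :: "nat \<Rightarrow> rat poly \<Rightarrow> rat poly \<Rightarrow> bool" where
  "dvd_in_S_poly q D B \<longleftrightarrow> (\<exists>C \<in> S_poly q. B = D * C)"

definition int_multiple_of_qpow :: "nat \<Rightarrow> int \<Rightarrow> rat \<Rightarrow> bool" where
  "int_multiple_of_qpow q k x \<longleftrightarrow> (\<exists>m :: int. x = of_int m * of_nat q powi k)"

end

theory Submission
  imports Defs
begin

text \<open>
  Let \<open>s\<close> be a slope with \<open>s > -\<nu>/N\<close> for one of the factors \<open>D = 1 - q\<^sup>-\<^sup>\<nu> t\<^sup>N\<close>.  Call a power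
  series of growth \<open>s\<close> if its \<open>i\<close>-th coefficient is an integer multiple of \<open>q\<close> to the power
  \<open>\<lceil>s i - a\<rceil>\<close>, for a constant \<open>a\<close>.  In \<open>q\<close>-adic terms, such a series converges on a disc
  that contains all zeros of \<open>D\<close> in its interior, so if \<open>P\<close> has growth \<open>s\<close>, then no zero of \<open>D\<close>
  can be a pole of \<open>P\<close>, and \<open>D\<close>, having simple zeros, must divide \<open>B\<close>.  The argument below
  makes this elementary, without constructing a \<open>p\<close>-adic field.

  Growth \<open>s\<close> is preserved by products (\<open>q_growth_mult\<close>), and each polynomial factor has growth \<open>s\<close> for
  every \<open>s\<close> (\<open>q_growth_denom_factor\<close>).  Hence \<open>G = P \<cdot> R\<close>, where \<open>R\<close> is the product of the
  factors other than \<open>D\<close>, still has growth \<open>s\<close>, and \<open>B = D \<cdot> G\<close>.  Beyond the degree of \<open>B\<close>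
  this equation reads \<open>G\<^sub>i\<^sub>+\<^sub>N = q\<^sup>-\<^sup>\<nu> G\<^sub>i\<close>: along steps of length \<open>N\<close> the \<open>q\<close>-divisibility
  of the coefficients changes with slope exactly \<open>-\<nu>/N\<close>, whereas growth demands the larger
  slope \<open>s\<close>.  So the coefficients in the tail are zero, since only zero is divisible by
  arbitrarily high powers of \<open>q\<close>; hence \<open>G\<close> is a polynomial and \<open>D\<close> divides \<open>B\<close>
  (\<open>denom_factor_dvd_if_q_growth\<close>).  Consequently \<open>l' \<le> -\<nu>\<^sub>j/N\<^sub>j\<close> for each \<open>j\<close>.
\<close>

section \<open>Divisibility by real powers of q\<close>

text \<open>
  Real exponents, rounded up, are used because \<open>\<lceil>y + z\<rceil> \<le> \<lceil>y\<rceil> + \<lceil>z\<rceil>\<close> lets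
  real lower bounds on the order of divisibility add up under multiplication, without rounding loss.
\<close>

definition q_div :: "nat \<Rightarrow> real \<Rightarrow> rat \<Rightarrow> bool" where
  "q_div q y x \<longleftrightarrow> int_multiple_of_qpow q \<lceil>y\<rceil> x"

lemma int_multiple_of_qpow_mono:
  assumes "q > 0" "k \<le> k'" "int_multiple_of_qpow q k' x"
  shows "int_multiple_of_qpow q k x"
proof -
  obtain m :: int where m: "x = of_int m * of_nat q powi k'"
    using assms(3) unfolding int_multiple_of_qpow_def by blast
  have "k' = int (nat (k' - k)) + k"
    using assms(2) by simp
  then have "(of_nat q :: rat) powi k' = of_nat q powi (int (nat (k' - k)) + k)"
    by (rule arg_cong)
  also have "\<dots> = of_nat q ^ nat (k' - k) * of_nat q powi k"
    using assms(1) by (simp only: power_int_add power_int_of_nat of_nat_eq_0_iff simp_thms neq0_conv)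
  finally have "x = of_int (m * int q ^ nat (k' - k)) * of_nat q powi k"
    using m by simp
  then show ?thesis unfolding int_multiple_of_qpow_def by blast
qed

lemma q_div_mono: "q > 0 \<Longrightarrow> y \<le> y' \<Longrightarrow> q_div q y' x \<Longrightarrow> q_div q y x"
  unfolding q_div_def by (meson int_multiple_of_qpow_mono ceiling_mono)

lemma q_div_0 [simp]: "q_div q y 0"
  unfolding q_div_def int_multiple_of_qpow_def by (rule exI[of _ 0]) simp

lemma q_div_minus: "q_div q y x \<Longrightarrow> q_div q y (- x)"
  unfolding q_div_def int_multiple_of_qpow_def by (metis mult_minus_left of_int_minus)

lemma q_div_add: "q_div q y x \<Longrightarrow> q_div q y z \<Longrightarrow> q_div q y (x + z)"
  unfolding q_div_def int_multiple_of_qpow_def by (metis distrib_right of_int_add)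

lemma q_div_sum: "(\<And>k. k \<in> A \<Longrightarrow> q_div q y (f k)) \<Longrightarrow> q_div q y (sum f A)"
  by (induction A rule: infinite_finite_induct) (auto intro: q_div_add)

lemma q_div_powi: "q_div q (of_int k) (of_nat q powi k)"
  unfolding q_div_def int_multiple_of_qpow_def by (rule exI[of _ 1]) simp

lemma q_div_mult:
  assumes "q > 0" "q_div q y x" "q_div q y' x'"
  shows "q_div q (y + y') (x * x')"
proof -
  obtain m m' :: int where "x = of_int m * of_nat q powi \<lceil>y\<rceil>" "x' = of_int m' * of_nat q powi \<lceil>y'\<rceil>"
    using assms(2,3) unfolding q_div_def int_multiple_of_qpow_def by blast
  then have "x * x' = of_int (m * m') * of_nat q powi (\<lceil>y\<rceil> + \<lceil>y'\<rceil>)"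
    using assms(1) by (simp add: power_int_add)
  then have "int_multiple_of_qpow q (\<lceil>y\<rceil> + \<lceil>y'\<rceil>) (x * x')"
    unfolding int_multiple_of_qpow_def by blast
  then show ?thesis
    unfolding q_div_def using assms(1) int_multiple_of_qpow_mono ceiling_add_le by blast
qed

lemma q_div_imp_S_ring:
  assumes "q > 0" "q_div q y x"
  shows "x \<in> S_ring q"
proof -
  have "int_multiple_of_qpow q (- int (nat \<bar>\<lceil>y\<rceil>\<bar>)) x"
    by (rule int_multiple_of_qpow_mono[OF assms(1) _ assms(2)[unfolded q_div_def]]) linarith
  then obtain m :: int where "x = of_int m * of_nat q powi (- int (nat \<bar>\<lceil>y\<rceil>\<bar>))"
    unfolding int_multiple_of_qpow_def by blast
  then have "x = of_int m / of_nat q ^ nat \<bar>\<lceil>y\<rceil>\<bar>"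
    by (simp only: power_int_minus power_int_of_nat divide_inverse)
  then show ?thesis unfolding S_ring_def by blast
qed

text \<open>
  The archimedean absolute value suffices: a nonzero integer multiple of \<open>q\<^sup>k\<close> has absolute value
  at least \<open>q\<^sup>k\<close>, which is unbounded in \<open>k\<close>.
\<close>

lemma q_div_all_imp_0:
  assumes "q \<ge> 2" and all: "\<And>y. q_div q y x"
  shows "x = 0"
proof (rule ccontr)
  assume "x \<noteq> 0"
  obtain k :: nat where k: "\<bar>x\<bar> < of_nat k" using reals_Archimedean2 by blast
  obtain m :: int where m: "x = of_int m * of_nat q powi int k"
    using all[of "real k"] unfolding q_div_def int_multiple_of_qpow_def by auto
  have "m \<noteq> 0" using m \<open>x \<noteq> 0\<close> by auto
  then have "(1 :: rat) \<le> \<bar>of_int m\<bar>" by linarith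
  have "k < q ^ k" using assms(1)
    by (meson less_exp order_less_le_trans power_mono zero_le)
  then have "(of_nat k :: rat) < of_nat q ^ k" by (metis of_nat_less_iff of_nat_power)
  also have "\<dots> = 1 * of_nat q ^ k" by simp
  also have "\<dots> \<le> \<bar>of_int m\<bar> * of_nat q ^ k"
    using \<open>(1 :: rat) \<le> \<bar>of_int m\<bar>\<close> by (rule mult_right_mono) simp
  also have "\<dots> = \<bar>x\<bar>" by (simp add: m abs_mult)
  finally show False using k by simp
qed

section \<open>Power series of prescribed q-adic growth\<close>

definition q_growth :: "nat \<Rightarrow> real \<Rightarrow> rat fps \<Rightarrow> bool" where
  "q_growth q s F \<longleftrightarrow> (\<exists>a. \<forall>i. q_div q (s * real i - a) (fps_nth F i))"

lemma q_growth_mult: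
  assumes "q > 0" "q_growth q s F" "q_growth q s G"
  shows "q_growth q s (F * G)"
proof -
  obtain a where a: "\<And>i. q_div q (s * real i - a) (fps_nth F i)"
    using assms(2) unfolding q_growth_def by blast
  obtain b where b: "\<And>i. q_div q (s * real i - b) (fps_nth G i)"
    using assms(3) unfolding q_growth_def by blast
  have "q_div q (s * real i - (a + b)) (fps_nth (F * G) i)" for i
    unfolding fps_mult_nth
  proof (rule q_div_sum)
    fix k assume k: "k \<in> {0..i}"
    have "q_div q ((s * real k - a) + (s * real (i - k) - b)) (fps_nth F k * fps_nth G (i - k))"
      by (intro q_div_mult assms(1) a b)
    moreover have "(s * real k - a) + (s * real (i - k) - b) = s * real i - (a + b)"
      using k by (simp add: of_nat_diff algebra_simps)
    ultimately show "q_div q (s * real i - (a + b)) (fps_nth F k * fps_nth G (i - k))"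
      by simp
  qed
  then show ?thesis unfolding q_growth_def by blast
qed

lemma q_growth_1: "q_growth q s 1"
proof -
  have "q_div q (s * real i - 0) (fps_nth 1 i)" for i
    using q_div_powi[of q 0] by (cases "i = 0") simp_all
  then show ?thesis unfolding q_growth_def by blast
qed

lemma q_growth_prod:
  assumes "q > 0" "\<And>j. j \<in> A \<Longrightarrow> q_growth q s (F j)"
  shows "q_growth q s (\<Prod>j\<in>A. F j)"
  using assms(2)
  by (induction A rule: infinite_finite_induct) (auto intro: q_growth_1 q_growth_mult[OF assms(1)])

text \<open>
  Growth constrains a polynomial at finitely many coefficients only, so the additive constant
  absorbs the constraint whatever the slope is.
\<close>

lemma q_growth_denom_factor:
  assumes "q > 0"
  shows "q_growth q s (fps_of_poly (denom_factor q \<nu> N))"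
proof -
  define a where "a = max 0 (s * real N + real \<nu>)"
  have const: "q_div q (s * real i - a) (if i = 0 then 1 else 0)" for i
  proof (cases "i = 0")
    case True
    have "q_div q 0 1" using q_div_powi[of q 0] by simp
    then have "q_div q (s * real 0 - a) 1"
      by (rule q_div_mono[OF assms, rotated]) (simp add: a_def)
    then show ?thesis using True by simp
  qed simp
  have top: "q_div q (s * real i - a) (if i = N then of_nat q powi (- int \<nu>) else 0)" for i
  proof (cases "i = N")
    case True
    have "q_div q (s * real N - a) (of_nat q powi (- int \<nu>))"
      by (rule q_div_mono[OF assms _ q_div_powi]) (simp add: a_def)
    then show ?thesis using True by simp
  qed simp
  have "fps_nth (fps_of_poly (denom_factor q \<nu> N)) i
      = (if i = 0 then 1 else 0) + - (if i = N then of_nat q powi (- int \<nu>) else 0)" for i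
    unfolding denom_factor_def by (auto simp: coeff_1)
  then have "\<forall>i. q_div q (s * real i - a) (fps_nth (fps_of_poly (denom_factor q \<nu> N)) i)"
    using q_div_add[OF const q_div_minus[OF top]] by simp
  then show ?thesis unfolding q_growth_def by blast
qed

text \<open>
  The elementary substitute for "a series converging at all zeros of \<open>D\<close> cannot have a pole
  there".  Slope strictly above \<open>-\<nu>/N\<close> is what forces the tail of \<open>G\<close>, which is multiplied by
  \<open>q\<^sup>-\<^sup>\<nu>\<close> at every step of length \<open>N\<close>, to vanish.  The quotient has its coefficients in \<open>S\<close>
  because growth allows only powers of \<open>q\<close> as their denominators.
\<close>

lemma denom_factor_dvd_if_q_growth:
  assumes q: "q \<ge> 2" and N: "N > 0"
    and growth: "q_growth q s G"
    and B: "fps_of_poly B = fps_of_poly (denom_factor q \<nu> N) * G"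
    and slope: "s > - real \<nu> / real N"
  shows "dvd_in_S_poly q (denom_factor q \<nu> N) B"
proof -
  have q0: "q > 0" using q by simp
  define c :: rat where "c = of_nat q powi (- int \<nu>)"
  obtain a where a: "\<And>i. q_div q (s * real i - a) (fps_nth G i)"
    using growth unfolding q_growth_def by blast
  have D: "fps_of_poly (denom_factor q \<nu> N) = 1 - fps_const c * fps_X ^ N"
    unfolding denom_factor_def c_def by (simp add: fps_of_poly_diff fps_of_poly_monom)
  have B': "fps_of_poly B = G - fps_const c * (fps_X ^ N * G)"
    unfolding B D by (simp add: algebra_simps)
  have step: "fps_nth G (i + N) = c * fps_nth G i" if "i > degree B" for i
  proof -
    have "0 = fps_nth (fps_of_poly B) (i + N)"
      using that by (simp add: coeff_eq_0)
    also have "\<dots> = fps_nth G (i + N) - c * fps_nth G i"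
      unfolding B' by (simp add: fps_X_power_mult_nth)
    finally show ?thesis by simp
  qed
  have iter: "fps_nth G (i + m * N) = c ^ m * fps_nth G i" if "i > degree B" for i m
  proof (induction m)
    case (Suc m)
    have "fps_nth G (i + Suc m * N) = fps_nth G ((i + m * N) + N)" by (simp add: algebra_simps)
    then show ?case using step[of "i + m * N"] that Suc by simp
  qed simp
  have gap: "s * real N + real \<nu> > 0"
    using slope N by (simp add: field_simps)
  have vanish: "fps_nth G i = 0" if i: "i > degree B" for i
  proof (rule q_div_all_imp_0[OF q])
    fix y :: real
    obtain m :: nat where m: "y - (s * real i - a) < real m * (s * real N + real \<nu>)"
      using reals_Archimedean3[OF gap] by blast
    have "q_div q (s * real (i + m * N) - a + of_int (int m * int \<nu>))
            (fps_nth G (i + m * N) * of_nat q powi (int m * int \<nu>))"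
      by (intro q_div_mult q0 a q_div_powi)
    moreover have "fps_nth G (i + m * N) * of_nat q powi (int m * int \<nu>) = fps_nth G i"
    proof -
      have "c ^ m * of_nat q powi (int m * int \<nu>) = (of_nat q powi (- int \<nu>) * of_nat q powi int \<nu>) ^ m"
        unfolding c_def power_mult_distrib by (simp add: power_int_mult mult.commute[of "int m"])
      also have "\<dots> = 1"
        using q0 by (simp add: power_int_minus)
      finally show ?thesis using iter[OF i, of m] by (simp add: algebra_simps)
    qed
    ultimately have "q_div q (s * real (i + m * N) - a + of_int (int m * int \<nu>)) (fps_nth G i)"
      by simp
    then show "q_div q y (fps_nth G i)"
      by (rule q_div_mono[OF q0, rotated]) (use m in \<open>simp add: algebra_simps\<close>)
  qed
  define C where "C = Abs_poly (fps_nth G)"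
  have coeff_C: "coeff C = fps_nth G"
    unfolding C_def using vanish by (intro coeff_Abs_poly[of "degree B"]) auto
  have "fps_of_poly C = G"
    by (rule fps_ext) (simp add: coeff_C)
  then have "fps_of_poly B = fps_of_poly (denom_factor q \<nu> N * C)"
    using B by (simp add: fps_of_poly_mult)
  then have "B = denom_factor q \<nu> N * C" by (simp only: fps_of_poly_eq_iff)
  moreover have "C \<in> S_poly q"
    unfolding S_poly_def using q_div_imp_S_ring[OF q0 a] by (simp add: coeff_C)
  ultimately show ?thesis unfolding dvd_in_S_poly_def by blast
qed

section \<open>The bound on the slope\<close>

theorem mainTheorem3:
  fixes q n :: nat
    and J :: "'j set"
    and \<nu> N :: "'j \<Rightarrow> nat"
    and B :: "rat poly"
    and P :: "rat fps"
    and M :: "nat \<Rightarrow> rat"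
    and l l' :: real
  assumes "primepow q"
    and "n > 0"
    and "finite J" and "J \<noteq> {}"
    and "\<And>j. j \<in> J \<Longrightarrow> \<nu> j > 0"
    and "\<And>j. j \<in> J \<Longrightarrow> N j > 0"
    and "B \<in> S_poly q"
    and "\<And>j. j \<in> J \<Longrightarrow> \<not> dvd_in_S_poly q (denom_factor q (\<nu> j) (N j)) B"
    and "P = fps_of_poly B / fps_of_poly (\<Prod>j\<in>J. denom_factor q (\<nu> j) (N j))"
    and "l = Min ((\<lambda>j. - real (\<nu> j) / real (N j)) ` J)"
    and "P = Abs_fps (\<lambda>i. M i * of_nat q powi (- (int n * int i)))"
    and "\<exists>a :: int. \<forall>i :: nat.
           int_multiple_of_qpow q \<lceil>(real n + l') * real i - real_of_int a\<rceil> (M i)"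
  shows "l' \<le> l"
proof -
  define D where "D = (\<lambda>j. fps_of_poly (denom_factor q (\<nu> j) (N j)))"
  have q: "q \<ge> 2" using primepow_gt_Suc_0[OF assms(1)] by simp
  then have q0: "q > 0" by simp
  have growth_P: "q_growth q l' P"
  proof -
    obtain a :: int where a: "\<And>i. q_div q ((real n + l') * real i - real_of_int a) (M i)"
      using assms(12) unfolding q_div_def by blast
    have "q_div q (l' * real i - real_of_int a) (fps_nth P i)" for i
    proof -
      have "q_div q (((real n + l') * real i - real_of_int a) + of_int (- (int n * int i)))
              (M i * of_nat q powi (- (int n * int i)))"
        by (intro q_div_mult q0 a q_div_powi)
      then show ?thesis by (simp add: assms(11) algebra_simps)
    qed
    then show ?thesis unfolding q_growth_def by blast
  qed
  have "fps_nth (D j) 0 = 1" if "j \<in> J" for j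
    unfolding D_def denom_factor_def using assms(6)[OF that] by simp
  then have "fps_nth (\<Prod>j\<in>A. D j) 0 = 1" if "A \<subseteq> J" for A
    using that by (induction A rule: infinite_finite_induct) auto
  then have D0: "fps_nth (\<Prod>j\<in>J. D j) 0 \<noteq> 0" by simp
  have "P = fps_of_poly B / (\<Prod>j\<in>J. D j)"
    unfolding D_def assms(9) by (simp add: fps_of_poly_prod)
  then have B: "fps_of_poly B = P * (\<Prod>j\<in>J. D j)"
    using D0 by (simp add: fps_divide_unit mult.assoc inverse_mult_eq_1)
  have "l' \<le> - real (\<nu> j) / real (N j)" if j: "j \<in> J" for j
  proof (rule ccontr)
    assume "\<not> l' \<le> - real (\<nu> j) / real (N j)"
    then have slope: "l' > - real (\<nu> j) / real (N j)" by simp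
    define G where "G = P * (\<Prod>k\<in>J - {j}. D k)"
    have "q_growth q l' G"
      unfolding G_def D_def
      by (intro q_growth_mult q_growth_prod q_growth_denom_factor growth_P q0)
    moreover have "fps_of_poly B = D j * G"
      unfolding B G_def using prod.remove[OF assms(3) j, of D] by (simp add: algebra_simps)
    ultimately have "dvd_in_S_poly q (denom_factor q (\<nu> j) (N j)) B"
      using denom_factor_dvd_if_q_growth[OF q assms(6)[OF j] _ _ slope] unfolding D_def by blast
    then show False using assms(8)[OF j] by blast
  qed
  then show ?thesis
    unfolding assms(10) using assms(3,4) by (subst Min_ge_iff) auto
qed

end
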